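(* The Banach space $c_0$ is isometrically represented by its unit ball; that is, the unit ball of $c_0$ is an isometrically representing subset of $c_0$.
   Context: Banach spaces are real. $c_0$ is the space of real sequences converging to $0$ with the supremum norm. A subset $K$ of a separable Banach space $X$ (with the metric induced by the norm) is called an isometrically representing subset of $X$ if, whenever $K$ embeds isometrically (via a distance-preserving, not necessarily linear or affine, map) into a Banach space $Y$, the space $X$ embeds linearly isometrically into $Y$. *)

theory Defs
  imports "HOL-Analysis.Analysis"
begin

typedef c0 = "{x :: nat \<Rightarrow> real. x \<longlonglongrightarrow> 0}"
  morphisms c0_seq Abs_c0
  by (rule exI [of _ "\<lambda>_. 0"]) simp

setup_lifting type_definition_c0

lemma c0_eqI: "(\<And>n. c0_seq x n = c0_seq y n) \<Longrightarrow> x = y"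
  by transfer auto

lemma c0_seq_tendsto: "c0_seq x \<longlonglongrightarrow> 0"
  using c0_seq [of x] by simp

lemma bdd_above_c0_seq: "bdd_above (range (\<lambda>n. \<bar>c0_seq x n\<bar>))"
proof -
  have "Bseq (c0_seq x)"
    using c0_seq_tendsto convergentI convergent_imp_Bseq by blast
  then show ?thesis
    by (auto simp: Bseq_def bdd_above_def)
qed

instantiation c0 :: real_vector
begin

lift_definition zero_c0 :: c0 is "\<lambda>_. 0" by simp

lift_definition plus_c0 :: "c0 \<Rightarrow> c0 \<Rightarrow> c0" is "\<lambda>x y n. x n + y n"
  using tendsto_add_zero by auto

lift_definition minus_c0 :: "c0 \<Rightarrow> c0 \<Rightarrow> c0" is "\<lambda>x y n. x n - y n"
  using tendsto_diff by fastforce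

lift_definition uminus_c0 :: "c0 \<Rightarrow> c0" is "\<lambda>x n. - x n"
  using tendsto_minus by fastforce

lift_definition scaleR_c0 :: "real \<Rightarrow> c0 \<Rightarrow> c0" is "\<lambda>r x n. r * x n"
  by (simp add: tendsto_mult_right_zero)

instance
  by standard (transfer; simp add: fun_eq_iff algebra_simps)+

end

instantiation c0 :: real_normed_vector
begin

definition norm_c0 :: "c0 \<Rightarrow> real"
  where "norm_c0 x = (SUP n. \<bar>c0_seq x n\<bar>)"

definition sgn_c0 :: "c0 \<Rightarrow> c0"
  where "sgn_c0 x = x /\<^sub>R norm x"

definition dist_c0 :: "c0 \<Rightarrow> c0 \<Rightarrow> real"
  where "dist_c0 x y = norm (x - y)"

definition uniformity_c0 :: "(c0 \<times> c0) filter"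
  where "uniformity_c0 = (INF e\<in>{0 <..}. principal {(x, y). dist x y < e})"

definition open_c0 :: "c0 set \<Rightarrow> bool"
  where "open_c0 S = (\<forall>x\<in>S. \<forall>\<^sub>F (x', y) in uniformity. x' = x \<longrightarrow> y \<in> S)"

lemma abs_c0_seq_le_norm: "\<bar>c0_seq x n\<bar> \<le> norm x"
  unfolding norm_c0_def by (rule cSUP_upper [OF UNIV_I bdd_above_c0_seq])

lemma norm_c0_le: "norm x \<le> b" if "\<And>n. \<bar>c0_seq x n\<bar> \<le> b"
  unfolding norm_c0_def using that by (intro cSUP_least) auto

instance
proof
  fix x y :: c0 and r :: real
  show "norm x = 0 \<longleftrightarrow> x = 0"
  proof
    assume "norm x = 0"
    then show "x = 0"
      using abs_c0_seq_le_norm [of x] by (intro c0_eqI) (simp add: zero_c0.rep_eq)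
  qed (simp add: norm_c0_def zero_c0.rep_eq)
  show "norm (x + y) \<le> norm x + norm y"
  proof (rule norm_c0_le)
    fix n
    show "\<bar>c0_seq (x + y) n\<bar> \<le> norm x + norm y"
      using abs_c0_seq_le_norm [of x n] abs_c0_seq_le_norm [of y n]
      by (simp add: plus_c0.rep_eq)
  qed
  have le: "norm (r *\<^sub>R x) \<le> \<bar>r\<bar> * norm x" for r and x :: c0
    by (rule norm_c0_le)
      (simp add: scaleR_c0.rep_eq abs_mult mult_left_mono abs_c0_seq_le_norm)
  show "norm (r *\<^sub>R x) = \<bar>r\<bar> * norm x"
  proof (cases "r = 0")
    case True
    then show ?thesis
      by (simp add: norm_c0_def zero_c0.rep_eq)
  next
    case False
    then have "norm x \<le> \<bar>inverse r\<bar> * norm (r *\<^sub>R x)"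
      using le [of "inverse r" "r *\<^sub>R x"] by simp
    with False have "\<bar>r\<bar> * norm x \<le> norm (r *\<^sub>R x)"
      by (simp add: field_simps)
    with le [of r x] show ?thesis by simp
  qed
qed (rule sgn_c0_def dist_c0_def open_c0_def uniformity_c0_def)+

end

instance c0 :: banach
proof
  fix f :: "nat \<Rightarrow> c0"
  assume "Cauchy f"
  have le: "dist (c0_seq x n) (c0_seq y n) \<le> dist x y" for x y n
    using abs_c0_seq_le_norm [of "x - y" n]
    by (simp add: dist_norm minus_c0.rep_eq)
  have "\<exists>N. \<forall>m n x. N \<le> m \<and> N \<le> n \<longrightarrow> dist (c0_seq (f m) x) (c0_seq (f n) x) < e"
    if "e > 0" for e
    using \<open>Cauchy f\<close> that unfolding Cauchy_def by (meson le order_le_less_trans)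
  then obtain g where g: "\<And>e. e > 0 \<Longrightarrow> \<exists>N. \<forall>n x. N \<le> n \<longrightarrow> dist (c0_seq (f n) x) (g x) < e"
    using uniformly_convergent_eq_cauchy [of "\<lambda>_. True" "\<lambda>n. c0_seq (f n)"] by auto
  have "g \<longlonglongrightarrow> 0"
  proof (rule LIMSEQ_I)
    fix e :: real
    assume "e > 0"
    then obtain N where N: "\<And>x. dist (c0_seq (f N) x) (g x) < e / 2"
      using g [of "e / 2"] by auto
    obtain M where "\<And>n. n \<ge> M \<Longrightarrow> \<bar>c0_seq (f N) n\<bar> < e / 2"
      using LIMSEQ_D [OF c0_seq_tendsto, of "e / 2" "f N"] \<open>e > 0\<close> by auto
    with N have "\<bar>g n\<bar> < e" if "n \<ge> M" for n
      using that N [of n] by (smt (verit) dist_real_def field_sum_of_halves)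
    then show "\<exists>M. \<forall>n\<ge>M. norm (g n - 0) < e" by auto
  qed
  then have rep: "c0_seq (Abs_c0 g) = g"
    by (simp add: Abs_c0_inverse)
  have "f \<longlonglongrightarrow> Abs_c0 g"
  proof (rule metric_LIMSEQ_I)
    fix e :: real
    assume "e > 0"
    then obtain N where N: "\<And>n x. N \<le> n \<Longrightarrow> dist (c0_seq (f n) x) (g x) < e / 2"
      using g [of "e / 2"] by auto
    have "dist (f n) (Abs_c0 g) \<le> e / 2" if "N \<le> n" for n
      unfolding dist_c0_def
      by (rule norm_c0_le)
        (use N [OF that] in \<open>simp add: minus_c0.rep_eq rep dist_real_def less_imp_le\<close>)
    with \<open>e > 0\<close> show "\<exists>N. \<forall>n\<ge>N. dist (f n) (Abs_c0 g) < e"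
      by (intro exI [of _ N]) fastforce
  qed
  then show "convergent f" by (rule convergentI)
qed

definition isometric_embedding_on :: "'a::metric_space set \<Rightarrow> ('a \<Rightarrow> 'b::metric_space) \<Rightarrow> bool"
  where "isometric_embedding_on K f \<longleftrightarrow> (\<forall>x\<in>K. \<forall>y\<in>K. dist (f x) (f y) = dist x y)"

definition linear_isometric_embedding ::
    "('a::real_normed_vector \<Rightarrow> 'b::real_normed_vector) \<Rightarrow> bool"
  where "linear_isometric_embedding T \<longleftrightarrow> linear T \<and> (\<forall>x. norm (T x) = norm x)"

text \<open>
  A definition cannot quantify over types, so the target Banach space \<open>Y\<close> is passed as
  a type argument. The set \<open>K\<close> is isometrically representing if the predicate holds for every
  type \<open>'y\<close> of class \<^class>\<open>banach\<close>, i.e. as a theorem with \<open>'y\<close> left as a type variable.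
\<close>

definition isometrically_representing :: "'y::banach itself \<Rightarrow> 'x::banach set \<Rightarrow> bool"
  where "isometrically_representing (Y :: 'y itself) K \<longleftrightarrow>
    separable_space (euclidean :: 'x topology) \<and>
    ((\<exists>f :: 'x \<Rightarrow> 'y. isometric_embedding_on K f) \<longrightarrow>
     (\<exists>T :: 'x \<Rightarrow> 'y. linear_isometric_embedding T))"

end

theory Submission
  imports Defs
begin

text \<open>
  Let \<open>f\<close> be an isometry from the unit ball of \<open>c\<^sub>0\<close> into a Banach space, and write \<open>e\<^sub>n\<close>
  for the unit vectors of \<open>c\<^sub>0\<close>. The linear embedding is a derivative at \<open>0\<close> of a smoothed
  copy of \<open>f\<close>, in the spirit of Godefroy and Kalton. Clipping coordinates to \<open>[-1, 1]\<close> is a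
  1-Lipschitz retraction of \<open>c\<^sub>0\<close> onto its ball, so \<open>f\<close> extends to a 1-Lipschitz map \<open>F\<close> on
  all of \<open>c\<^sub>0\<close>.

  Smoothing means averaging \<open>F\<close> over the points \<open>x + \<Sum>\<^sub>k t\<^sub>k e\<^sub>k\<close>, where the \<open>t\<^sub>k\<close> are independent
  and uniform on \<open>[0, 2\<^bsup>-(k+3)\<^esup>]\<close>. The binary digits of the \<open>t\<^sub>k\<close> turn this integral into a limit
  of finite averages over subset sums of the vectors \<open>2\<^bsup>-j\<^esup> e\<^sub>k\<close> with \<open>j \<ge> k + 4\<close>. These vectors
  have summable norms, so the averages converge in norm and no
  compactness is needed, although infinitely many directions are smoothed at once. Since
  averaging over the binary digits of \<open>t\<^sub>n\<close> turns a difference quotient of small step in direction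
  \<open>e\<^sub>n\<close> into a fixed multiple of a difference of a 1-Lipschitz function over a fixed step
  (\<open>subset_sum_average_dyadic_difference\<close>), the difference quotients in direction \<open>e\<^sub>n\<close> converge to
  some \<open>y\<^sub>n\<close> (\<open>smoothed_quotient_convergent\<close>) and are Lipschitz uniformly in the step size. Hence
  quotients at different nearby points may be telescoped along a path, which gives
  \<open>\<parallel>\<Sum> \<plusminus>y\<^sub>n\<parallel> \<le> \<parallel>\<Sum> \<plusminus>e\<^sub>n\<parallel> = 1\<close> (\<open>norm_signed_sum_smoothed_derivatives_le\<close>).

  The other ingredient is \<open>\<parallel>y\<^sub>n\<parallel> \<ge> 1\<close> (\<open>norm_smoothed_quotient_ge\<close>). If \<open>\<parallel>z\<parallel> \<le> 1/2\<close>, the distances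
  from \<open>z\<close> to \<open>e\<^sub>n\<close> and to \<open>-e\<^sub>n\<close> are \<open>1 - z\<^sub>n\<close> and \<open>1 + z\<^sub>n\<close>, affine functions of \<open>z\<close>; so
  averaging loses nothing in the triangle inequality along \<open>f(-e\<^sub>n)\<close>, two averages of \<open>f\<close> near \<open>0\<close>,
  and \<open>f(e\<^sub>n)\<close>, whose end points are at distance \<open>2\<close>.

  These two facts suffice: convexity extends the upper bound to all coefficients of modulus at most
  \<open>1\<close>, and if \<open>b\<^sub>m\<close> is a coefficient of largest modulus, then \<open>2 b\<^sub>m y\<^sub>m\<close> is the sum of
  \<open>\<Sum> b\<^sub>n y\<^sub>n\<close> and of a combination of norm at most \<open>\<bar>b\<^sub>m\<bar>\<close>, which gives the lower bound. Therefore
  \<open>x \<mapsto> \<Sum> x\<^sub>n y\<^sub>n\<close> is a linear isometric embedding.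
\<close>

section \<open>Averages over subset sums\<close>

text \<open>
  The average of \<open>F\<close> over the points \<open>x + \<Sum>\<^sub>i \<beta>\<^sub>i v\<^sub>i\<close> with independent fair bits \<open>\<beta>\<^sub>i\<close>. It is the
  product of the operators \<open>F \<mapsto> (F + F(\<cdot> + v\<^sub>i)) / 2\<close>; the closed form makes it evident that these
  commute.
\<close>

definition subset_sum_average ::
    "('i \<Rightarrow> 'a::real_vector) \<Rightarrow> 'i set \<Rightarrow> ('a \<Rightarrow> 'b::real_vector) \<Rightarrow> 'a \<Rightarrow> 'b"
  where "subset_sum_average v I F x = (\<Sum>A\<in>Pow I. F (x + sum v A)) /\<^sub>R 2 ^ card I"

lemma subset_sum_average_insert:
  assumes "finite I" "i \<notin> I"
  shows "subset_sum_average v (insert i I) F x =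
    (subset_sum_average v I F x + subset_sum_average v I F (x + v i)) /\<^sub>R 2"
proof -
  have disj: "Pow I \<inter> insert i ` Pow I = {}"
    using assms(2) by auto
  have inj: "inj_on (insert i) (Pow I)"
    using assms(2) by (auto simp: inj_on_def)
  have "(\<Sum>A\<in>Pow (insert i I). F (x + sum v A)) =
      (\<Sum>A\<in>Pow I. F (x + sum v A)) + (\<Sum>A\<in>Pow I. F (x + sum v (insert i A)))"
    unfolding Pow_insert using assms(1) disj inj
    by (subst sum.union_disjoint) (auto simp: sum.reindex)
  also have "(\<Sum>A\<in>Pow I. F (x + sum v (insert i A))) = (\<Sum>A\<in>Pow I. F (x + v i + sum v A))"
  proof (rule sum.cong)
    fix A assume "A \<in> Pow I"
    then have "finite A" "i \<notin> A"
      using assms finite_subset by auto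
    then show "F (x + sum v (insert i A)) = F (x + v i + sum v A)"
      by (simp add: add.assoc)
  qed simp
  finally show ?thesis
    using assms by (simp add: subset_sum_average_def scaleR_add_right)
qed

text \<open>
  The pointwise bound may depend on the subset sum. This matters for the lower bound on
  difference quotients, where an average of distances has to be computed and not just estimated.
\<close>

lemma norm_subset_sum_average_diff_le:
  fixes F G :: "'a::real_vector \<Rightarrow> 'b::real_normed_vector"
  assumes "finite I" "\<And>A. A \<subseteq> I \<Longrightarrow> norm (F (x + sum v A) - G (y + sum v A)) \<le> g (sum v A)"
  shows "norm (subset_sum_average v I F x - subset_sum_average v I G y)
    \<le> subset_sum_average v I g 0"
proof -
  have "norm (subset_sum_average v I F x - subset_sum_average v I G y) =
      norm (\<Sum>A\<in>Pow I. F (x + sum v A) - G (y + sum v A)) / 2 ^ card I"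
    unfolding subset_sum_average_def
    by (simp flip: scaleR_diff_right sum_subtractf) (simp add: field_simps)
  also have "\<dots> \<le> (\<Sum>A\<in>Pow I. g (sum v A)) / 2 ^ card I"
    using assms(2) by (intro divide_right_mono sum_norm_le) auto
  finally show ?thesis
    by (simp add: subset_sum_average_def field_simps)
qed

lemma subset_sum_average_const:
  "finite I \<Longrightarrow> subset_sum_average v I (\<lambda>_. c) x = c"
  by (simp add: subset_sum_average_def card_Pow sum_constant_scaleR)

lemma subset_sum_average_lipschitz:
  fixes F :: "'a::real_normed_vector \<Rightarrow> 'b::real_normed_vector"
  assumes "finite I" "\<And>x y. norm (F x - F y) \<le> norm (x - y)"
  shows "norm (subset_sum_average v I F x - subset_sum_average v I F y) \<le> norm (x - y)"
proof -
  have "norm (subset_sum_average v I F x - subset_sum_average v I F y)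
      \<le> subset_sum_average v I (\<lambda>_. norm (x - y)) 0"
  proof (rule norm_subset_sum_average_diff_le[OF assms(1)])
    fix A
    show "norm (F (x + sum v A) - F (y + sum v A)) \<le> norm (x - y)"
      using assms(2)[of "x + sum v A" "y + sum v A"] by simp
  qed
  then show ?thesis
    using assms(1) by (simp add: subset_sum_average_const)
qed

lemma subset_sum_average_union_diff_le:
  fixes F :: "'a::real_normed_vector \<Rightarrow> 'b::real_normed_vector"
  assumes "finite I" "finite K" "I \<inter> K = {}"
    and lip: "\<And>x y. norm (F x - F y) \<le> norm (x - y)"
  shows "norm (subset_sum_average v (I \<union> K) F x - subset_sum_average v I F x)
    \<le> (\<Sum>i\<in>K. norm (v i))"
  using assms(2,3)
proof (induction K rule: finite_induct)
  case (insert k K)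
  let ?S = "subset_sum_average v (I \<union> K) F"
  have "subset_sum_average v (I \<union> insert k K) F x - ?S x = (?S (x + v k) - ?S x) /\<^sub>R 2"
  proof -
    have "(a + b) /\<^sub>R 2 - a = (b - a) /\<^sub>R 2" for a b :: 'b
    proof -
      have "(a + b) /\<^sub>R 2 - a = (a + b) /\<^sub>R 2 - (a /\<^sub>R 2 + a /\<^sub>R 2)"
        by (simp flip: scaleR_add_left)
      also have "\<dots> = (b - a) /\<^sub>R 2"
        unfolding scaleR_add_right scaleR_diff_right by simp
      finally show ?thesis .
    qed
    then show ?thesis
      using insert assms(1) by (simp add: subset_sum_average_insert)
  qed
  then have "norm (subset_sum_average v (I \<union> insert k K) F x - ?S x) \<le> norm (v k)"
    using subset_sum_average_lipschitz[of "I \<union> K" F v "x + v k" x] insert(1) assms(1) lip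
      norm_ge_zero[of "v k"] by (simp del: norm_ge_zero)
  with insert have "norm ((subset_sum_average v (I \<union> insert k K) F x - ?S x) +
      (?S x - subset_sum_average v I F x)) \<le> norm (v k) + (\<Sum>i\<in>K. norm (v i))"
    by (intro norm_triangle_mono) auto
  then show ?case
    using insert by simp
qed simp

section \<open>Difference quotients of dyadic averages\<close>

definition dyadic_vector :: "(nat \<Rightarrow> 'a::real_vector) \<Rightarrow> nat \<times> nat \<Rightarrow> 'a"
  where "dyadic_vector e = (\<lambda>(k, j). (1 / 2) ^ j *\<^sub>R e k)"

text \<open>
  One averaging step halves both the step size and the difference: if \<open>G\<close> is the average of
  \<open>H\<close> and \<open>H(\<cdot> + w)\<close>, then \<open>G(x + w) - G(x) = (H(x + 2w) - H(x)) / 2\<close>. Iterating this over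
  \<open>w = 2\<^bsup>-j\<^esup> e\<^sub>n\<close> shows that the quotient at the finest scale is exactly a quotient at the coarse
  scale \<open>2\<^bsup>1-a\<^esup>\<close> of the average that omits direction \<open>n\<close>. This is the discrete
  form of the fundamental theorem of calculus.
\<close>

lemma subset_sum_average_dyadic_difference:
  fixes e :: "nat \<Rightarrow> 'a::real_vector" and F :: "'a \<Rightarrow> 'b::real_vector" and a :: nat
  assumes "finite I" "\<And>j. (n, j) \<notin> I"
  defines "S \<equiv> (\<lambda>m. subset_sum_average (dyadic_vector e) (I \<union> {n} \<times> {a..<a + m}) F)"
  shows "S m (x + (2 * (1 / 2) ^ (a + m)) *\<^sub>R e n) - S m x =
    (1 / 2) ^ m *\<^sub>R (S 0 (x + (2 * (1 / 2) ^ a) *\<^sub>R e n) - S 0 x)"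
proof (induction m)
  case (Suc m)
  let ?h = "(1 / 2) ^ (a + m) :: real"
  have "I \<union> {n} \<times> {a..<a + Suc m} = insert (n, a + m) (I \<union> {n} \<times> {a..<a + m})"
    by auto
  then have ins: "S (Suc m) z = (S m z + S m (z + ?h *\<^sub>R e n)) /\<^sub>R 2" for z
    unfolding S_def using assms(1,2)
    by (simp add: subset_sum_average_insert dyadic_vector_def)
  have two: "2 * (1 / 2) ^ (a + Suc m) = ?h"
    by simp
  have "S (Suc m) (x + ?h *\<^sub>R e n) - S (Suc m) x =
      (S m (x + (2 * ?h) *\<^sub>R e n) - S m x) /\<^sub>R 2"
    unfolding ins mult_2 scaleR_add_left add.assoc[symmetric]
    by (simp add: algebra_simps)
  also have "\<dots> = (1 / 2) ^ Suc m *\<^sub>R (S 0 (x + (2 * (1 / 2) ^ a) *\<^sub>R e n) - S 0 x)"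
    unfolding Suc.IH by simp
  finally show ?case
    unfolding two .
qed simp

text \<open>
  Starting direction \<open>k\<close> at scale \<open>2\<^bsup>-(k+4)\<^esup>\<close> makes the norms of all vectors summable over both
  indices. The offset \<open>4\<close> keeps the total at most \<open>1/4\<close>, so that the averaging stays well inside
  the unit ball.
\<close>

definition dyadic_triangle :: "nat \<Rightarrow> (nat \<times> nat) set"
  where "dyadic_triangle J = Sigma {..<J} (\<lambda>k. {k + 4..<J})"

lemma finite_dyadic_triangle [simp]: "finite (dyadic_triangle J)"
  by (auto simp: dyadic_triangle_def)

lemma sum_half_powers_le: "(\<Sum>j\<in>{a..<b}. (1 / 2) ^ j) \<le> (2 * (1 / 2) ^ a :: real)"
proof -
  have "a \<le> b \<Longrightarrow> (\<Sum>j\<in>{a..<b}. (1 / 2) ^ j) = (2 * (1 / 2) ^ a - 2 * (1 / 2) ^ b :: real)"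
    by (induction b rule: dec_induct) auto
  then show ?thesis
    by (cases "a \<le> b") auto
qed

lemma sum_norm_dyadic_triangle_le:
  fixes e :: "nat \<Rightarrow> 'a::real_normed_vector"
  assumes "\<And>n. norm (e n) \<le> 1"
  shows "(\<Sum>i\<in>dyadic_triangle J. norm (dyadic_vector e i)) \<le> 1 / 4"
proof -
  have "(\<Sum>i\<in>dyadic_triangle J. norm (dyadic_vector e i))
      \<le> (\<Sum>(k, j)\<in>dyadic_triangle J. (1 / 2) ^ j)"
    using assms by (intro sum_mono) (auto simp: dyadic_vector_def field_simps)
  also have "\<dots> = (\<Sum>k<J. \<Sum>j\<in>{k + 4..<J}. (1 / 2) ^ j)"
    unfolding dyadic_triangle_def by (subst sum.Sigma) auto
  also have "\<dots> \<le> (\<Sum>k<J. 2 * (1 / 2) ^ (k + 4))"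
    by (intro sum_mono sum_half_powers_le)
  also have "\<dots> = (\<Sum>k\<in>{0..<J}. (1 / 2) ^ k) / 8"
    by (simp add: power_add sum_divide_distrib lessThan_atLeast0 eval_nat_numeral)
  also have "\<dots> \<le> 1 / 4"
    using sum_half_powers_le[of 0 J] by simp
  finally show ?thesis .
qed

text \<open>
  The step is \<open>2\<^bsup>1-J\<^esup>\<close>, twice the length of the finest vectors in the \<open>J\<close>-th triangle, because
  this is the step at which the halving identity applies.
\<close>

definition smoothed_quotient ::
    "(nat \<Rightarrow> 'a::real_vector) \<Rightarrow> ('a \<Rightarrow> 'b::real_vector) \<Rightarrow> nat \<Rightarrow> nat \<Rightarrow> 'a \<Rightarrow> 'b"
  where "smoothed_quotient e F J n x =
    (let S = subset_sum_average (dyadic_vector e) (dyadic_triangle J) F; h = 2 * (1 / 2) ^ J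
     in (S (x + h *\<^sub>R e n) - S x) /\<^sub>R h)"

text \<open>
  On the right the step \<open>2\<^bsup>-(n+3)\<^esup>\<close> is independent of \<open>J\<close>. Both the Lipschitz bound uniform in \<open>J\<close>
  and the convergence of the quotients rest on this.
\<close>

lemma smoothed_quotient_eq:
  fixes e :: "nat \<Rightarrow> 'a::real_vector" and F :: "'a \<Rightarrow> 'b::real_vector"
  assumes "n + 4 \<le> J"
  defines "S \<equiv> subset_sum_average (dyadic_vector e) (dyadic_triangle J - {n} \<times> UNIV) F"
  shows "smoothed_quotient e F J n x = 2 ^ (n + 3) *\<^sub>R (S (x + (1 / 2) ^ (n + 3) *\<^sub>R e n) - S x)"
proof -
  obtain m where J: "J = n + 4 + m"
    using assms(1) le_Suc_ex by blast
  have tri: "dyadic_triangle J - {n} \<times> UNIV \<union> {n} \<times> {n + 4..<n + 4 + m} = dyadic_triangle J"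
    by (auto simp: dyadic_triangle_def J)
  have h: "2 * (1 / 2) ^ (n + 4) = ((1 / 2) ^ (n + 3) :: real)"
    by (simp add: power_add eval_nat_numeral)
  have c: "inverse (2 * (1 / 2) ^ J) * (1 / 2) ^ m = (2 ^ (n + 3) :: real)"
    by (simp add: J power_add field_simps)
  show ?thesis
    unfolding smoothed_quotient_def Let_def S_def
    using subset_sum_average_dyadic_difference[of "dyadic_triangle J - {n} \<times> UNIV" n e
        "n + 4" m F x, unfolded tri h, folded J]
    by (simp add: c[symmetric])
qed

lemma smoothed_quotient_lipschitz:
  fixes F :: "'a::real_normed_vector \<Rightarrow> 'b::real_normed_vector"
  assumes lip: "\<And>x y. norm (F x - F y) \<le> norm (x - y)" and "n + 4 \<le> J"
  shows "norm (smoothed_quotient e F J n x - smoothed_quotient e F J n y)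
    \<le> 2 ^ (n + 4) * norm (x - y)"
proof -
  define S where "S = subset_sum_average (dyadic_vector e) (dyadic_triangle J - {n} \<times> UNIV) F"
  define w where "w = (1 / 2) ^ (n + 3) *\<^sub>R e n"
  have S: "norm (S u - S v) \<le> norm (u - v)" for u v
    unfolding S_def by (intro subset_sum_average_lipschitz lip) auto
  have "smoothed_quotient e F J n x - smoothed_quotient e F J n y =
      2 ^ (n + 3) *\<^sub>R ((S (x + w) - S (y + w)) - (S x - S y))"
    using assms(2) by (simp add: smoothed_quotient_eq S_def w_def algebra_simps)
  also have "norm \<dots> \<le> 2 ^ (n + 3) * (norm (x - y) + norm (x - y))"
    using S[of "x + w" "y + w"] S[of x y]
    by (auto intro!: mult_left_mono order_trans[OF norm_triangle_ineq4] add_mono)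
  finally show ?thesis
    by (simp add: power_add)
qed

lemma convergent_if_summable_increments:
  fixes f :: "nat \<Rightarrow> 'a::banach"
  assumes "summable g" "\<And>n. n \<ge> N \<Longrightarrow> norm (f (Suc n) - f n) \<le> g n"
  shows "convergent f"
proof -
  have "summable (\<lambda>n. f (Suc n) - f n)"
  proof (rule summable_comparison_test)
    show "\<exists>N. \<forall>n\<ge>N. norm (f (Suc n) - f n) \<le> g n"
      using assms(2) by (intro exI[of _ N] allI impI)
  qed (rule assms(1))
  then have "(\<lambda>n. (\<Sum>i<n. f (Suc i) - f i) + f 0) \<longlonglongrightarrow> (\<Sum>n. f (Suc n) - f n) + f 0"
    by (intro tendsto_add summable_LIMSEQ tendsto_const)
  then show ?thesis
    unfolding sum_lessThan_telescope diff_add_cancel by (rule convergentI)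
qed

text \<open>
  Passing from \<open>J\<close> to \<open>J + 1\<close> adds at most \<open>J\<close> vectors, each of norm at most \<open>2\<^bsup>-J\<^esup>\<close>, so the
  averages, and with them the quotients at a fixed coarse step, change by a summable amount.
\<close>

lemma smoothed_quotient_convergent:
  fixes F :: "'a::real_normed_vector \<Rightarrow> 'b::banach"
  assumes lip: "\<And>x y. norm (F x - F y) \<le> norm (x - y)" and e: "\<And>n. norm (e n) \<le> 1"
  shows "convergent (\<lambda>J. smoothed_quotient e F J n x)"
proof (rule convergent_if_summable_increments)
  have "summable (\<lambda>J. real (Suc J) * (1 / 2) ^ J)"
    using geometric_deriv_sums[of "1 / 2 :: real"] by (simp add: sums_iff)
  then show "summable (\<lambda>J. 2 ^ (n + 4) * (real (Suc J) * (1 / 2) ^ J))"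
    by (rule summable_mult)
next
  fix J assume J: "n + 4 \<le> J"
  define I where "I = (\<lambda>J. dyadic_triangle J - {n} \<times> UNIV)"
  define S where "S = (\<lambda>J. subset_sum_average (dyadic_vector e) (I J) F)"
  define w where "w = (1 / 2) ^ (n + 3) *\<^sub>R e n"
  have I: "I (Suc J) = I J \<union> (I (Suc J) - I J)"
    by (auto simp: I_def dyadic_triangle_def)
  have sub: "I (Suc J) - I J \<subseteq> (\<lambda>k. (k, J)) ` {..<J}"
    by (auto simp: I_def dyadic_triangle_def)
  have S: "norm (S (Suc J) z - S J z) \<le> real (Suc J) * (1 / 2) ^ J" for z
  proof -
    have "norm (S (Suc J) z - S J z) \<le> (\<Sum>i\<in>I (Suc J) - I J. norm (dyadic_vector e i))"
      unfolding S_def by (subst I, rule subset_sum_average_union_diff_le) (auto simp: lip I_def)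
    also have "\<dots> \<le> (\<Sum>i\<in>(\<lambda>k. (k, J)) ` {..<J}. norm (dyadic_vector e i))"
      using sub by (intro sum_mono2) auto
    also have "\<dots> = (\<Sum>k<J. norm (dyadic_vector e (k, J)))"
      by (subst sum.reindex) (auto simp: inj_on_def)
    also have "\<dots> \<le> (\<Sum>k<J. (1 / 2) ^ J)"
      using e by (intro sum_mono) (auto simp: dyadic_vector_def field_simps)
    also have "\<dots> \<le> real (Suc J) * (1 / 2) ^ J"
      by simp
    finally show ?thesis .
  qed
  have "smoothed_quotient e F (Suc J) n x - smoothed_quotient e F J n x =
      2 ^ (n + 3) *\<^sub>R ((S (Suc J) (x + w) - S J (x + w)) - (S (Suc J) x - S J x))"
    using J by (simp add: smoothed_quotient_eq S_def w_def I_def algebra_simps)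
  also have "norm \<dots> \<le> 2 ^ (n + 3) * (real (Suc J) * (1 / 2) ^ J + real (Suc J) * (1 / 2) ^ J)"
    unfolding norm_scaleR
    by (intro mult_mono order_trans[OF norm_triangle_ineq4] add_mono S) auto
  also have "\<dots> = 2 ^ (n + 4) * (real (Suc J) * (1 / 2) ^ J)"
    by (simp add: power_add)
  finally show "norm (smoothed_quotient e F (Suc J) n x - smoothed_quotient e F J n x)
      \<le> 2 ^ (n + 4) * (real (Suc J) * (1 / 2) ^ J)" .
qed

text \<open>
  Walk from \<open>0\<close> to \<open>h \<Sum> \<epsilon>\<^sub>n e\<^sub>n\<close> one coordinate at a time. The increments of the
  average along the path are \<open>h \<epsilon>\<^sub>n\<close> times difference quotients with base points near \<open>0\<close>, and
  their sum has norm at most the distance of the end points. As \<open>h\<close> tends to \<open>0\<close>, the uniform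
  Lipschitz bound allows all base points to be moved to \<open>0\<close>.
\<close>

lemma norm_signed_sum_smoothed_derivatives_le:
  fixes F :: "'a::real_normed_vector \<Rightarrow> 'b::real_normed_vector"
  assumes lip: "\<And>x y. norm (F x - F y) \<le> norm (x - y)"
    and y: "\<And>n. (\<lambda>J. smoothed_quotient e F J n 0) \<longlonglongrightarrow> y n"
    and \<epsilon>: "\<And>n. \<epsilon> n \<in> {1, -1 :: real}"
  shows "norm (\<Sum>n<N. \<epsilon> n *\<^sub>R y n) \<le> norm (\<Sum>n<N. \<epsilon> n *\<^sub>R e n)"
proof -
  define h where "h = (\<lambda>J. 2 * (1 / 2) ^ J :: real)"
  define S where "S = (\<lambda>J. subset_sum_average (dyadic_vector e) (dyadic_triangle J) F)"
  define s where "s = (\<lambda>n. \<Sum>i<n. \<epsilon> i *\<^sub>R e i)"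
  \<comment> \<open>Quotients use forward steps only, so for a negative sign the base point is the end of the
    step.\<close>
  define p where "p = (\<lambda>n. if \<epsilon> n = 1 then s n else s (Suc n))"
  have h0: "h J > 0" for J
    by (simp add: h_def)
  have hlim: "h \<longlonglongrightarrow> 0"
    unfolding h_def by (intro tendsto_mult_right_zero LIMSEQ_power_zero) simp
  have step: "\<epsilon> n *\<^sub>R smoothed_quotient e F J n (h J *\<^sub>R p n) =
      (S J (h J *\<^sub>R s (Suc n)) - S J (h J *\<^sub>R s n)) /\<^sub>R h J" for J n
  proof (cases "\<epsilon> n = 1")
    case True
    then have "h J *\<^sub>R s (Suc n) = h J *\<^sub>R s n + h J *\<^sub>R e n"
      by (simp add: s_def algebra_simps)
    with True show ?thesis
      by (simp add: smoothed_quotient_def Let_def p_def S_def h_def)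
  next
    case False
    then have eps: "\<epsilon> n = -1"
      using \<epsilon>[of n] by auto
    then have "h J *\<^sub>R s (Suc n) + h J *\<^sub>R e n = h J *\<^sub>R s n"
      by (simp add: s_def algebra_simps)
    with eps show ?thesis
      by (simp add: smoothed_quotient_def Let_def p_def S_def h_def flip: scaleR_minus_right)
  qed
  have bound: "norm (\<Sum>n<N. \<epsilon> n *\<^sub>R smoothed_quotient e F J n (h J *\<^sub>R p n)) \<le> norm (s N)" for J
  proof -
    have "(\<Sum>n<N. \<epsilon> n *\<^sub>R smoothed_quotient e F J n (h J *\<^sub>R p n)) =
        (\<Sum>n<N. S J (h J *\<^sub>R s (Suc n)) - S J (h J *\<^sub>R s n)) /\<^sub>R h J"
      by (simp add: step scaleR_sum_right)
    also have "\<dots> = (S J (h J *\<^sub>R s N) - S J 0) /\<^sub>R h J"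
      by (subst sum_lessThan_telescope) (simp add: s_def)
    also have "norm \<dots> \<le> norm (h J *\<^sub>R s N - 0) / h J"
      using subset_sum_average_lipschitz[of "dyadic_triangle J" F "dyadic_vector e" "h J *\<^sub>R s N" 0]
        lip h0[of J]
      by (simp add: S_def divide_simps mult.commute)
    also have "\<dots> = norm (s N)"
      using h0[of J] by simp
    finally show ?thesis .
  qed
  have lim: "(\<lambda>J. smoothed_quotient e F J n (h J *\<^sub>R p n)) \<longlonglongrightarrow> y n" for n
  proof (rule Lim_transform2[OF y])
    have "\<forall>\<^sub>F J in sequentially. norm (smoothed_quotient e F J n 0
        - smoothed_quotient e F J n (h J *\<^sub>R p n)) \<le> 2 ^ (n + 4) * (h J * norm (p n))"
      using eventually_ge_at_top[of "n + 4"]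
    proof eventually_elim
      case (elim J)
      then show ?case
        using smoothed_quotient_lipschitz[of F n J e 0 "h J *\<^sub>R p n"] lip h0[of J] by simp
    qed
    moreover have "(\<lambda>J. 2 ^ (n + 4) * (h J * norm (p n))) \<longlonglongrightarrow> 0"
      by (intro tendsto_mult_right_zero tendsto_mult_left_zero hlim)
    ultimately show "(\<lambda>J. smoothed_quotient e F J n 0
        - smoothed_quotient e F J n (h J *\<^sub>R p n)) \<longlonglongrightarrow> 0"
      by (rule Lim_null_comparison)
  qed
  have "(\<lambda>J. norm (\<Sum>n<N. \<epsilon> n *\<^sub>R smoothed_quotient e F J n (h J *\<^sub>R p n)))
      \<longlonglongrightarrow> norm (\<Sum>n<N. \<epsilon> n *\<^sub>R y n)"
    by (intro tendsto_norm tendsto_sum tendsto_scaleR tendsto_const lim)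
  then show ?thesis
    using bound unfolding s_def by (intro LIMSEQ_le_const2) auto
qed

section \<open>Sequences that span a copy of \<open>c\<^sub>0\<close>\<close>

text \<open>
  The cube is the convex hull of its vertices and the norm is convex. The vector \<open>z\<close> carries
  the coordinates already fixed in the induction.
\<close>

lemma norm_sum_le_of_signs:
  fixes y :: "nat \<Rightarrow> 'a::real_normed_vector"
  assumes "\<And>\<epsilon>. (\<And>n. \<epsilon> n \<in> {1, -1 :: real}) \<Longrightarrow> norm (z + (\<Sum>n<N. \<epsilon> n *\<^sub>R y n)) \<le> C"
    and "\<And>n. \<bar>b n\<bar> \<le> 1"
  shows "norm (z + (\<Sum>n<N. b n *\<^sub>R y n)) \<le> C"
  using assms(1)
proof (induction N arbitrary: z)
  case 0
  then show ?case
    using 0[of "\<lambda>_. 1"] by simp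
next
  case (Suc N)
  define r where "r = (\<Sum>n<N. b n *\<^sub>R y n)"
  have ext: "norm (z + \<sigma> *\<^sub>R y N + r) \<le> C" if "\<sigma> \<in> {1, -1}" for \<sigma>
    unfolding r_def
  proof (rule Suc.IH)
    fix \<epsilon> :: "nat \<Rightarrow> real"
    assume "\<And>n. \<epsilon> n \<in> {1, -1}"
    then have "norm (z + (\<Sum>n<Suc N. (\<epsilon>(N := \<sigma>)) n *\<^sub>R y n)) \<le> C"
      using that by (intro Suc.prems) auto
    then show "norm (z + \<sigma> *\<^sub>R y N + (\<Sum>n<N. \<epsilon> n *\<^sub>R y n)) \<le> C"
      by (simp add: algebra_simps)
  qed
  have "z + (\<Sum>n<Suc N. b n *\<^sub>R y n) =
      ((1 + b N) / 2) *\<^sub>R (z + 1 *\<^sub>R y N + r) + ((1 - b N) / 2) *\<^sub>R (z + (-1) *\<^sub>R y N + r)"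
  proof -
    have "u + t *\<^sub>R w = ((1 + t) / 2) *\<^sub>R (u + w) + ((1 - t) / 2) *\<^sub>R (u - w)" for u w :: 'a and t
    proof -
      have "((1 + t) / 2) *\<^sub>R (u + w) + ((1 - t) / 2) *\<^sub>R (u - w) =
          ((1 + t) / 2 + (1 - t) / 2) *\<^sub>R u + ((1 + t) / 2 - (1 - t) / 2) *\<^sub>R w"
        unfolding scaleR_add_left scaleR_diff_left scaleR_add_right scaleR_diff_right by simp
      moreover have "(1 + t) / 2 + (1 - t) / 2 = 1" "(1 + t) / 2 - (1 - t) / 2 = t"
        by (simp_all add: field_simps)
      ultimately show ?thesis
        by simp
    qed
    from this[of "z + r" "b N" "y N"] show ?thesis
      by (simp add: r_def ac_simps)
  qed
  then have "norm (z + (\<Sum>n<Suc N. b n *\<^sub>R y n)) =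
      norm (((1 + b N) / 2) *\<^sub>R (z + 1 *\<^sub>R y N + r) + ((1 - b N) / 2) *\<^sub>R (z + (-1) *\<^sub>R y N + r))"
    by (rule arg_cong)
  also have "\<dots> \<le> ((1 + b N) / 2) * C + ((1 - b N) / 2) * C"
    using ext[of 1] ext[of "-1"] assms(2)[of N]
    by (intro norm_triangle_mono) (auto simp: mult_left_mono abs_le_iff)
  also have "\<dots> = C"
    by (simp add: field_simps)
  finally show ?case .
qed

text \<open>
  The lower bound comes from the upper one: flipping the signs of all coefficients except a
  largest one, \<open>b\<^sub>m\<close>, gives a second combination of norm at most \<open>\<bar>b\<^sub>m\<bar>\<close>, and the two add up to
  \<open>2 b\<^sub>m y\<^sub>m\<close>, of norm at least \<open>2 \<bar>b\<^sub>m\<bar>\<close>.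
\<close>

lemma norm_c0_combination:
  fixes y :: "nat \<Rightarrow> 'a::real_normed_vector"
  assumes signs: "\<And>\<epsilon> N. (\<And>n. \<epsilon> n \<in> {1, -1 :: real}) \<Longrightarrow> norm (\<Sum>n<N. \<epsilon> n *\<^sub>R y n) \<le> 1"
    and y: "\<And>n. norm (y n) \<ge> 1"
  shows norm_c0_combination_le:
      "\<And>b N C. (\<And>n. \<bar>b n\<bar> \<le> C) \<Longrightarrow> norm (\<Sum>n<N. b n *\<^sub>R y n) \<le> C"
    and norm_c0_combination_ge:
      "\<And>b N k. k < N \<Longrightarrow> \<bar>b k\<bar> \<le> norm (\<Sum>n<N. b n *\<^sub>R y n)"
proof -
  show le: "norm (\<Sum>n<N. b n *\<^sub>R y n) \<le> C" if b: "\<And>n. \<bar>b n\<bar> \<le> C" for b N C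
  proof (cases "C = 0")
    case True
    then show ?thesis
      using b by simp
  next
    case False
    then have C: "C > 0"
      using b[of 0] by linarith
    have "norm (0 + (\<Sum>n<N. (b n / C) *\<^sub>R y n)) \<le> 1"
    proof (rule norm_sum_le_of_signs)
      show "norm (0 + (\<Sum>n<N. \<epsilon> n *\<^sub>R y n)) \<le> 1"
        if "\<And>n. \<epsilon> n \<in> {1, -1}" for \<epsilon> :: "nat \<Rightarrow> real"
        unfolding add_0 using that by (rule signs)
      show "\<bar>b n / C\<bar> \<le> 1" for n
        using b[of n] C by simp
    qed
    moreover have "(\<Sum>n<N. (b n / C) *\<^sub>R y n) = (\<Sum>n<N. b n *\<^sub>R y n) /\<^sub>R C"
      by (simp add: scaleR_sum_right divide_inverse mult.commute)
    ultimately show ?thesis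
      using C by (simp add: field_simps)
  qed
  show "\<bar>b k\<bar> \<le> norm (\<Sum>n<N. b n *\<^sub>R y n)" if "k < N" for b N k
  proof -
    let ?B = "(\<lambda>n. \<bar>b n\<bar>) ` {..<N}"
    have "finite ?B" "?B \<noteq> {}"
      using that by auto
    from Max_in[OF this] obtain m where m: "m < N" and Max: "Max ?B = \<bar>b m\<bar>"
      by (elim imageE) simp
    have max: "\<bar>b n\<bar> \<le> \<bar>b m\<bar>" if "n < N" for n
      using that Max_ge[OF \<open>finite ?B\<close>, of "\<bar>b n\<bar>"] unfolding Max by blast
    define b' where "b' = (\<lambda>n. if n = m then b m else if n < N then - b n else 0)"
    have "norm (\<Sum>n<N. b' n *\<^sub>R y n) \<le> \<bar>b m\<bar>"
      using max by (intro le) (auto simp: b'_def)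
    moreover have "(\<Sum>n<N. b n *\<^sub>R y n) + (\<Sum>n<N. b' n *\<^sub>R y n) = (2 * b m) *\<^sub>R y m"
    proof -
      have "(\<Sum>n<N. b n *\<^sub>R y n) + (\<Sum>n<N. b' n *\<^sub>R y n) =
          (\<Sum>n<N. if n = m then (2 * b m) *\<^sub>R y m else 0)"
        unfolding sum.distrib[symmetric]
      proof (rule sum.cong)
        fix n assume "n \<in> {..<N}"
        then show "b n *\<^sub>R y n + b' n *\<^sub>R y n = (if n = m then (2 * b m) *\<^sub>R y m else 0)"
          by (simp add: b'_def flip: scaleR_add_left)
      qed simp
      then show ?thesis
        using m by simp
    qed
    moreover have "2 * \<bar>b m\<bar> * 1 \<le> norm ((2 * b m) *\<^sub>R y m)"
      using y[of m] by (simp add: abs_mult mult_left_mono mult_le_cancel_left1)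
    ultimately have "\<bar>b m\<bar> \<le> norm (\<Sum>n<N. b n *\<^sub>R y n)"
      using norm_triangle_ineq[of "\<Sum>n<N. b n *\<^sub>R y n" "\<Sum>n<N. b' n *\<^sub>R y n"] by simp
    with max[OF that] show ?thesis
      by linarith
  qed
qed

lemma linear_isometric_embedding_c0I:
  fixes y :: "nat \<Rightarrow> 'a::banach"
  assumes signs: "\<And>\<epsilon> N. (\<And>n. \<epsilon> n \<in> {1, -1 :: real}) \<Longrightarrow> norm (\<Sum>n<N. \<epsilon> n *\<^sub>R y n) \<le> 1"
    and y: "\<And>n. norm (y n) \<ge> 1"
  shows "linear_isometric_embedding (\<lambda>x. \<Sum>n. c0_seq x n *\<^sub>R y n)"
proof -
  note le = norm_c0_combination_le[of y, OF signs y]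
  note ge = norm_c0_combination_ge[of y, OF signs y]
  have summ: "summable (\<lambda>n. c0_seq x n *\<^sub>R y n)" for x
    unfolding summable_Cauchy
  proof (intro allI impI)
    fix r :: real
    assume "r > 0"
    then obtain M where M: "\<And>n. n \<ge> M \<Longrightarrow> \<bar>c0_seq x n\<bar> < r / 2"
      using LIMSEQ_D[OF c0_seq_tendsto, of "r / 2" x] by auto
    have "norm (\<Sum>i = m..<n. c0_seq x i *\<^sub>R y i) < r" if "m \<ge> M" for m n
    proof -
      have "(\<Sum>i = m..<n. c0_seq x i *\<^sub>R y i) =
          (\<Sum>i<n. (if m \<le> i then c0_seq x i else 0) *\<^sub>R y i)"
        by (rule sum.mono_neutral_cong_left) auto
      also have "norm \<dots> \<le> r / 2"
        using M that \<open>r > 0\<close> by (intro le) (auto simp: less_imp_le)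
      finally show ?thesis
        using \<open>r > 0\<close> by linarith
    qed
    then show "\<exists>N. \<forall>m\<ge>N. \<forall>n. norm (\<Sum>i = m..<n. c0_seq x i *\<^sub>R y i) < r"
      by blast
  qed
  have lim: "(\<lambda>N. norm (\<Sum>n<N. c0_seq x n *\<^sub>R y n)) \<longlonglongrightarrow> norm (\<Sum>n. c0_seq x n *\<^sub>R y n)" for x
    by (intro tendsto_norm summable_LIMSEQ summ)
  have "norm (\<Sum>n. c0_seq x n *\<^sub>R y n) = norm x" for x
  proof (rule antisym)
    show "norm (\<Sum>n. c0_seq x n *\<^sub>R y n) \<le> norm x"
      using le[of "c0_seq x" "norm x"] abs_c0_seq_le_norm[of x]
      by (intro LIMSEQ_le_const2[OF lim]) auto
    show "norm x \<le> norm (\<Sum>n. c0_seq x n *\<^sub>R y n)"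
    proof (rule norm_c0_le)
      fix k
      show "\<bar>c0_seq x k\<bar> \<le> norm (\<Sum>n. c0_seq x n *\<^sub>R y n)"
        using ge[of k _ "c0_seq x"]
        by (intro LIMSEQ_le_const[OF lim] exI[of _ "Suc k"]) auto
    qed
  qed
  moreover have "linear (\<lambda>x. \<Sum>n. c0_seq x n *\<^sub>R y n)"
    by (intro linearI)
      (simp_all add: plus_c0.rep_eq scaleR_c0.rep_eq scaleR_add_left suminf_add[OF summ summ]
        suminf_scaleR_right[OF summ] flip: scaleR_scaleR)
  ultimately show ?thesis
    by (simp add: linear_isometric_embedding_def)
qed

section \<open>The geometry of \<open>c\<^sub>0\<close>\<close>

lift_definition c0_unit :: "nat \<Rightarrow> c0" is "\<lambda>n k. if k = n then 1 else 0"
proof (rule tendsto_eventually)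
  fix n
  show "\<forall>\<^sub>F k in sequentially. (if k = n then 1 else 0 :: real) = 0"
    using eventually_gt_at_top[of n] by eventually_elim simp
qed

lift_definition c0_clip :: "c0 \<Rightarrow> c0" is "\<lambda>x n. max (- 1) (min 1 (x n))"
proof -
  fix x :: "nat \<Rightarrow> real"
  assume "x \<longlonglongrightarrow> 0"
  then have "(\<lambda>n. max (- 1) (min 1 (x n))) \<longlonglongrightarrow> max (- 1) (min 1 0)"
    by (intro tendsto_intros)
  then show "(\<lambda>n. max (- 1) (min 1 (x n))) \<longlonglongrightarrow> 0"
    by simp
qed

lemma c0_clip_in_cball: "c0_clip x \<in> cball 0 1"
  by (auto simp: c0_clip.rep_eq intro!: norm_c0_le)

lemma c0_clip_eq: "norm x \<le> 1 \<Longrightarrow> c0_clip x = x"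
  using abs_c0_seq_le_norm[of x] order_trans
  by (intro c0_eqI) (fastforce simp: c0_clip.rep_eq abs_le_iff max_def min_def)

lemma c0_clip_lipschitz: "norm (c0_clip x - c0_clip y) \<le> norm (x - y)"
proof (rule norm_c0_le)
  fix n
  have "\<bar>c0_seq (c0_clip x - c0_clip y) n\<bar> \<le> \<bar>c0_seq (x - y) n\<bar>"
    by (auto simp: c0_clip.rep_eq minus_c0.rep_eq max_def min_def)
  also have "\<dots> \<le> norm (x - y)"
    by (rule abs_c0_seq_le_norm)
  finally show "\<bar>c0_seq (c0_clip x - c0_clip y) n\<bar> \<le> norm (x - y)" .
qed

lemma norm_c0_unit: "norm (c0_unit n) = 1"
proof (rule antisym)
  show "norm (c0_unit n) \<le> 1"
    by (rule norm_c0_le) (simp add: c0_unit.rep_eq)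
  show "1 \<le> norm (c0_unit n)"
    using abs_c0_seq_le_norm[of "c0_unit n" n] by (simp add: c0_unit.rep_eq)
qed

lemma c0_seq_sum: "c0_seq (sum f A) k = (\<Sum>a\<in>A. c0_seq (f a) k)"
  by (induction A rule: infinite_finite_induct) (auto simp: zero_c0.rep_eq plus_c0.rep_eq)

lemma norm_signed_sum_c0_unit_le:
  assumes "\<And>n. \<epsilon> n \<in> {1, -1 :: real}"
  shows "norm (\<Sum>n<N. \<epsilon> n *\<^sub>R c0_unit n) \<le> 1"
proof (rule norm_c0_le)
  fix k
  have "c0_seq (\<Sum>n<N. \<epsilon> n *\<^sub>R c0_unit n) k = (\<Sum>n<N. if n = k then \<epsilon> k else 0)"
    unfolding c0_seq_sum by (intro sum.cong) (auto simp: scaleR_c0.rep_eq c0_unit.rep_eq)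
  then show "\<bar>c0_seq (\<Sum>n<N. \<epsilon> n *\<^sub>R c0_unit n) k\<bar> \<le> 1"
    using assms[of k] by auto
qed

text \<open>
  Coordinate \<open>n\<close> of the difference has modulus \<open>1 - s z\<^sub>n \<ge> 1/2\<close> and dominates all others. So near
  \<open>0\<close> the distance to \<open>\<plusminus>e\<^sub>n\<close> is affine.
\<close>

lemma norm_c0_unit_diff_le:
  assumes "norm z \<le> 1 / 2" "\<bar>s\<bar> = 1"
  shows "norm (s *\<^sub>R c0_unit n - z) \<le> 1 - s * c0_seq z n"
proof (rule norm_c0_le)
  fix k
  have "\<bar>c0_seq z k\<bar> \<le> 1 / 2" for k
    using abs_c0_seq_le_norm[of z k] assms(1) by linarith
  from this[of n] this[of k] assms(2)
  show "\<bar>c0_seq (s *\<^sub>R c0_unit n - z) k\<bar> \<le> 1 - s * c0_seq z n"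
    by (auto simp: minus_c0.rep_eq scaleR_c0.rep_eq c0_unit.rep_eq abs_if split: if_splits)
qed

text \<open>
  With \<open>S\<close> the averaged map and \<open>c\<close> the mean of the \<open>n\<close>-th coordinate of the shifts, the
  distances from \<open>f(e\<^sub>n)\<close> to \<open>S(h e\<^sub>n)\<close> and from \<open>S(0)\<close> to \<open>f(-e\<^sub>n)\<close> are at most \<open>1 - h - c\<close> and
  \<open>1 + c\<close>. Since \<open>f(e\<^sub>n)\<close> and \<open>f(-e\<^sub>n)\<close> are at distance \<open>2\<close>, at least \<open>h\<close> remains for
  \<open>S(h e\<^sub>n) - S(0)\<close>. No cancellation occurs in the average, although the differences
  \<open>f(x + h e\<^sub>n) - f(x)\<close> need not be parallel.
\<close>

lemma norm_smoothed_quotient_ge: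
  fixes f :: "c0 \<Rightarrow> 'b::real_normed_vector"
  assumes iso: "isometric_embedding_on (cball 0 1) f" and J: "J \<ge> 3"
  shows "norm (smoothed_quotient c0_unit (f \<circ> c0_clip) J n 0) \<ge> 1"
proof -
  define h :: real where "h = 2 * (1 / 2) ^ J"
  define S where "S = (subset_sum_average (dyadic_vector c0_unit) (dyadic_triangle J)
    :: (c0 \<Rightarrow> 'b) \<Rightarrow> c0 \<Rightarrow> 'b)"
  define c where "c = subset_sum_average (dyadic_vector c0_unit) (dyadic_triangle J)
    (\<lambda>z. c0_seq z n) 0"
  have "(1 / 2 :: real) ^ J \<le> (1 / 2) ^ 3"
    using J by (intro power_decreasing) auto
  then have h: "0 < h" "h \<le> 1 / 4"
    by (auto simp: h_def power3_eq_cube)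
  have bound: "norm (f (s *\<^sub>R c0_unit n) - S (f \<circ> c0_clip) (t *\<^sub>R c0_unit n)) \<le> 1 - s * (t + c)"
    if s: "\<bar>s\<bar> = 1" and t: "0 \<le> t" "t \<le> 1 / 4" for s t
  proof -
    let ?v = "dyadic_vector c0_unit" and ?I = "dyadic_triangle J"
    have "norm (S (\<lambda>_. f (s *\<^sub>R c0_unit n)) 0 - S (f \<circ> c0_clip) (t *\<^sub>R c0_unit n))
        \<le> subset_sum_average ?v ?I (\<lambda>z. 1 - s * (t + c0_seq z n)) 0"
      unfolding S_def
    proof (rule norm_subset_sum_average_diff_le)
      fix A assume A: "A \<subseteq> ?I"
      define z where "z = t *\<^sub>R c0_unit n + sum ?v A"
      have "norm (sum ?v A) \<le> (\<Sum>i\<in>?I. norm (?v i))"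
        using A by (intro order_trans[OF norm_sum] sum_mono2) auto
      also have "\<dots> \<le> 1 / 4"
        by (intro sum_norm_dyadic_triangle_le) (simp add: norm_c0_unit)
      finally have "norm z \<le> 1 / 4 + 1 / 4"
        unfolding z_def using t by (intro norm_triangle_mono) (auto simp: norm_c0_unit)
      then have z: "norm z \<le> 1 / 2"
        by simp
      then have "norm (f (s *\<^sub>R c0_unit n) - f (c0_clip z)) = norm (s *\<^sub>R c0_unit n - z)"
        using iso s by (simp add: isometric_embedding_on_def c0_clip_eq norm_c0_unit dist_norm)
      also have "\<dots> \<le> 1 - s * c0_seq z n"
        using z s by (rule norm_c0_unit_diff_le)
      finally show "norm (f (s *\<^sub>R c0_unit n) - (f \<circ> c0_clip) (t *\<^sub>R c0_unit n + sum ?v A))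
          \<le> 1 - s * (t + c0_seq (sum ?v A) n)"
        by (simp add: z_def plus_c0.rep_eq scaleR_c0.rep_eq c0_unit.rep_eq)
    qed simp
    also have "S (\<lambda>_. f (s *\<^sub>R c0_unit n)) 0 = f (s *\<^sub>R c0_unit n)"
      by (simp add: S_def subset_sum_average_const)
    also have "subset_sum_average ?v ?I (\<lambda>z. 1 - s * (t + c0_seq z n)) 0 = 1 - s * (t + c)"
      by (simp add: c_def subset_sum_average_def sum_subtractf sum.distrib card_Pow
          flip: sum_distrib_left) (simp add: field_simps)
    finally show ?thesis .
  qed
  have "2 = norm (1 *\<^sub>R c0_unit n - (- 1) *\<^sub>R c0_unit n)"
    by (simp add: norm_c0_unit flip: scaleR_2)
  also have "\<dots> = norm (f (1 *\<^sub>R c0_unit n) - f ((- 1) *\<^sub>R c0_unit n))"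
    using iso by (simp add: isometric_embedding_on_def norm_c0_unit dist_norm)
  also have "\<dots> \<le> norm (f (1 *\<^sub>R c0_unit n) - S (f \<circ> c0_clip) (h *\<^sub>R c0_unit n)) +
      norm (S (f \<circ> c0_clip) (h *\<^sub>R c0_unit n) - S (f \<circ> c0_clip) (0 *\<^sub>R c0_unit n)) +
      norm (f ((- 1) *\<^sub>R c0_unit n) - S (f \<circ> c0_clip) (0 *\<^sub>R c0_unit n))"
    by norm
  also have "\<dots> \<le> 2 - h + norm (S (f \<circ> c0_clip) (h *\<^sub>R c0_unit n) - S (f \<circ> c0_clip) 0)"
    using bound[of 1 h] bound[of "-1" 0] h by simp
  finally show ?thesis
    using h unfolding smoothed_quotient_def Let_def S_def h_def[symmetric]
    by (simp add: divide_simps)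
qed

section \<open>Separability and the embedding\<close>

lift_definition c0_of_rats :: "rat list \<Rightarrow> c0"
  is "\<lambda>qs n. if n < length qs then of_rat (qs ! n) else 0"
proof (rule tendsto_eventually)
  fix qs :: "rat list"
  show "\<forall>\<^sub>F n in sequentially. (if n < length qs then of_rat (qs ! n) else 0 :: real) = 0"
    using eventually_ge_at_top[of "length qs"] by eventually_elim simp
qed

lemma separable_space_c0: "separable_space (euclidean :: c0 topology)"
  unfolding separable_space_def
proof (intro exI conjI)
  show "countable (range c0_of_rats)"
    by simp
  have "x \<in> closure (range c0_of_rats)" for x
    unfolding closure_approachable
  proof (intro allI impI)
    fix r :: real
    assume r: "r > 0"
    then obtain M where M: "\<And>n. n \<ge> M \<Longrightarrow> \<bar>c0_seq x n\<bar> < r / 2"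
      using LIMSEQ_D[OF c0_seq_tendsto, of "r / 2" x] by auto
    have "\<exists>q. \<bar>of_rat q - c0_seq x n\<bar> < r / 2" for n
    proof -
      obtain q where "c0_seq x n < of_rat q" "of_rat q < c0_seq x n + r / 2"
        using of_rat_dense[of "c0_seq x n" "c0_seq x n + r / 2"] r by auto
      then show ?thesis
        by (intro exI[of _ q]) linarith
    qed
    then obtain q where q: "\<And>n. \<bar>of_rat (q n) - c0_seq x n\<bar> < r / 2"
      by metis
    have "norm (c0_of_rats (map q [0..<M]) - x) \<le> r / 2"
    proof (rule norm_c0_le)
      fix n
      show "\<bar>c0_seq (c0_of_rats (map q [0..<M]) - x) n\<bar> \<le> r / 2"
        using M[of n] q[of n] by (auto simp: c0_of_rats.rep_eq minus_c0.rep_eq)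
    qed
    then show "\<exists>y\<in>range c0_of_rats. dist y x < r"
      using r by (auto simp: dist_norm intro!: exI[of _ "map q [0..<M]"])
  qed
  then show "euclidean closure_of range c0_of_rats = topspace euclidean"
    by auto
qed simp

theorem corollary4p2:
  shows "isometrically_representing TYPE('y::banach) (cball (0::c0) 1)"
  unfolding isometrically_representing_def
proof (intro conjI impI separable_space_c0)
  assume "\<exists>f :: c0 \<Rightarrow> 'y. isometric_embedding_on (cball 0 1) f"
  then obtain f :: "c0 \<Rightarrow> 'y" where f: "isometric_embedding_on (cball 0 1) f"
    by blast
  define F where "F = f \<circ> c0_clip"
  have lip: "norm (F x - F z) \<le> norm (x - z)" for x z
  proof -
    have "norm (F x - F z) = norm (c0_clip x - c0_clip z)"
      using f c0_clip_in_cball by (simp add: F_def isometric_embedding_on_def dist_norm)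
    then show ?thesis
      using c0_clip_lipschitz by simp
  qed
  have "convergent (\<lambda>J. smoothed_quotient c0_unit F J n 0)" for n
    by (rule smoothed_quotient_convergent) (simp_all add: lip norm_c0_unit)
  then obtain y where y: "\<And>n. (\<lambda>J. smoothed_quotient c0_unit F J n 0) \<longlonglongrightarrow> y n"
    unfolding convergent_def by metis
  have "linear_isometric_embedding (\<lambda>x. \<Sum>n. c0_seq x n *\<^sub>R y n)"
  proof (rule linear_isometric_embedding_c0I)
    fix \<epsilon> :: "nat \<Rightarrow> real" and N
    assume \<epsilon>: "\<And>n. \<epsilon> n \<in> {1, -1}"
    show "norm (\<Sum>n<N. \<epsilon> n *\<^sub>R y n) \<le> 1"
      by (rule order_trans[OF norm_signed_sum_smoothed_derivatives_le norm_signed_sum_c0_unit_le])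
        (rule lip y \<epsilon>)+
  next
    fix n
    show "norm (y n) \<ge> 1"
      using norm_smoothed_quotient_ge[OF f]
      by (intro LIMSEQ_le_const[OF tendsto_norm[OF y]] exI[of _ 3]) (auto simp: F_def)
  qed
  then show "\<exists>T :: c0 \<Rightarrow> 'y. linear_isometric_embedding T"
    by blast
qed

end
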